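(* Let $(\Omega,T)$ be a topologically mixing subshift of finite type. Let $\mu$ be a $T$-ergodic Borel probability measure with full support on $\Omega$ that has the bounded distortion property. Let $f\in C^\alpha(\Omega,\mathbb R)$ for some $0<\alpha\le1$. Then for each $\varepsilon>0$ there exist $C,c>0$, depending on $f$, $\alpha$ and $\varepsilon$, such that $$\mu\Big\{\omega\in\Omega:\Big|\frac1n\sum_{k=0}^{n-1}f(T^k\omega)-\int_\Omega f\,d\mu\Big|\ge\varepsilon\Big\}<Ce^{-cn}\quad\text{for all }n\ge1.$$
   Context: Let $\mathcal A=\{1,\dots,\ell\}$, $\ell\ge2$, and let $T$ be the left shift $(T\omega)_n=\omega_{n+1}$ on $\mathcal A^{\mathbb Z}$, with the metric $d(\omega,\tilde\omega)=e^{-N(\omega,\tilde\omega)}$, $N(\omega,\tilde\omega)=\max\{N\ge0:\omega_n=\tilde\omega_n\text{ for all }|n|<N\}$ ($d=0$ if $\omega=\tilde\omega$). A subshift of finite type is a non-empty set $\Omega=\{\omega\in\mathcal A^{\mathbb Z}:Q_{\omega_n\omega_{n+1}}=1\ \forall n\in\mathbb Z\}$ for some $0$-$1$ matrix $Q$, with $T$ restricted to $\Omega$. It is topologically mixing if for all non-empty open $U,V\subset\Omega$ there is $N\ge1$ with $T^n(U)\cap V\ne\varnothing$ for all $n\ge N$. Cylinders: $[n;j_0,\dots,j_k]=\{\omega\in\Omega:\omega_{n+i}=j_i,\ 0\le i\le k\}$. The measure $\mu$ has the bounded distortion property if there is $C\ge1$ such that for all non-empty cylinders $[n;j_0,\dots,j_k]$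 and $[l;i_0,\dots,i_m]$ in $\Omega$ with $l>n+k$ and $[n;j_0,\dots,j_k]\cap[l;i_0,\dots,i_m]\ne\varnothing$, $$C^{-1}\le\frac{\mu([n;j_0,\dots,j_k]\cap[l;i_0,\dots,i_m])}{\mu([n;j_0,\dots,j_k])\,\mu([l;i_0,\dots,i_m])}\le C.$$ $C^\alpha(\Omega,\mathbb R)$ is the space of $\alpha$-Hölder continuous functions with respect to $d$. *)

theory Defs
  imports "HOL-Probability.Probability"
begin

text \<open>Two-sided sequences over the alphabet $\{1,\dots,\ell\}$ are functions of type
  \<^typ>\<open>int \<Rightarrow> nat\<close> with all values in \<open>{1..l}\<close>.\<close>

definition full_shift :: "nat \<Rightarrow> (int \<Rightarrow> nat) set" where
  "full_shift l = {w. \<forall>n. w n \<in> {1..l}}"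

definition shift :: "(int \<Rightarrow> nat) \<Rightarrow> (int \<Rightarrow> nat)" where
  "shift w = (\<lambda>n. w (n + 1))"

definition agreement :: "(int \<Rightarrow> nat) \<Rightarrow> (int \<Rightarrow> nat) \<Rightarrow> nat" where
  "agreement w v = Max {N. \<forall>n. \<bar>n\<bar> < int N \<longrightarrow> w n = v n}"

definition seq_dist :: "(int \<Rightarrow> nat) \<Rightarrow> (int \<Rightarrow> nat) \<Rightarrow> real" where
  "seq_dist w v = (if w = v then 0 else exp (- real (agreement w v)))"

definition subshift_of_finite_type :: "nat \<Rightarrow> (int \<Rightarrow> nat) set \<Rightarrow> bool" where
  "subshift_of_finite_type l \<Omega> \<longleftrightarrow>
     \<Omega> \<noteq> {} \<and>
     (\<exists>Q :: nat \<Rightarrow> nat \<Rightarrow> nat.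
        (\<forall>i\<in>{1..l}. \<forall>j\<in>{1..l}. Q i j \<in> {0, 1}) \<and>
        \<Omega> = {w \<in> full_shift l. \<forall>n. Q (w n) (w (n + 1)) = 1})"

text \<open>The topology that the metric induces on \<open>\<Omega>\<close>. The constant \<open>Metric_space.mtopology\<close> is
  meaningful only for an actual metric, which \<open>seq_dist\<close> is by \<open>Metric_space_seq_dist\<close> below.\<close>

abbreviation seq_topology :: "(int \<Rightarrow> nat) set \<Rightarrow> (int \<Rightarrow> nat) topology" where
  "seq_topology \<Omega> \<equiv> Metric_space.mtopology \<Omega> seq_dist"

definition seq_borel :: "(int \<Rightarrow> nat) set \<Rightarrow> (int \<Rightarrow> nat) measure" where
  "seq_borel \<Omega> = sigma \<Omega> {U. openin (seq_topology \<Omega>) U}"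

definition topologically_mixing :: "(int \<Rightarrow> nat) set \<Rightarrow> bool" where
  "topologically_mixing \<Omega> \<longleftrightarrow>
     (\<forall>U V. openin (seq_topology \<Omega>) U \<and> U \<noteq> {} \<and> openin (seq_topology \<Omega>) V \<and> V \<noteq> {} \<longrightarrow>
        (\<exists>N\<ge>1. \<forall>n\<ge>N. (shift ^^ n) ` U \<inter> V \<noteq> {}))"

definition full_support :: "(int \<Rightarrow> nat) set \<Rightarrow> (int \<Rightarrow> nat) measure \<Rightarrow> bool" where
  "full_support \<Omega> \<mu> \<longleftrightarrow> (\<forall>U. openin (seq_topology \<Omega>) U \<and> U \<noteq> {} \<longrightarrow> measure \<mu> U > 0)"

text \<open>Ergodicity of a probability measure includes invariance of the measure.\<close>

definition ergodic :: "'a measure \<Rightarrow> ('a \<Rightarrow> 'a) \<Rightarrow> bool" where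
  "ergodic \<mu> T \<longleftrightarrow>
     T \<in> measurable \<mu> \<mu> \<and> distr \<mu> \<mu> T = \<mu> \<and>
     (\<forall>A\<in>sets \<mu>. T -` A \<inter> space \<mu> = A \<longrightarrow> measure \<mu> A = 0 \<or> measure \<mu> A = 1)"

text \<open>\<open>cylinder \<Omega> n k j\<close> is $[n; j_0, \dots, j_k]$; only the values of \<open>j\<close> on \<open>{0..k}\<close> matter.\<close>

definition cylinder :: "(int \<Rightarrow> nat) set \<Rightarrow> int \<Rightarrow> nat \<Rightarrow> (nat \<Rightarrow> nat) \<Rightarrow> (int \<Rightarrow> nat) set" where
  "cylinder \<Omega> n k j = {w \<in> \<Omega>. \<forall>i\<le>k. w (n + int i) = j i}"

text \<open>Non-emptiness of the two cylinders follows from that of their intersection.\<close>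

definition bounded_distortion :: "(int \<Rightarrow> nat) set \<Rightarrow> (int \<Rightarrow> nat) measure \<Rightarrow> bool" where
  "bounded_distortion \<Omega> \<mu> \<longleftrightarrow>
     (\<exists>C\<ge>1. \<forall>n k j l m i.
        l > n + int k \<and> cylinder \<Omega> n k j \<inter> cylinder \<Omega> l m i \<noteq> {} \<longrightarrow>
          inverse C \<le> measure \<mu> (cylinder \<Omega> n k j \<inter> cylinder \<Omega> l m i) /
                        (measure \<mu> (cylinder \<Omega> n k j) * measure \<mu> (cylinder \<Omega> l m i)) \<and>
          measure \<mu> (cylinder \<Omega> n k j \<inter> cylinder \<Omega> l m i) /
            (measure \<mu> (cylinder \<Omega> n k j) * measure \<mu> (cylinder \<Omega> l m i)) \<le> C)"

definition hoelder_on :: "real \<Rightarrow> (int \<Rightarrow> nat) set \<Rightarrow> ((int \<Rightarrow> nat) \<Rightarrow> real) \<Rightarrow> bool" where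
  "hoelder_on \<alpha> \<Omega> f \<longleftrightarrow>
     (\<exists>K. \<forall>w\<in>\<Omega>. \<forall>v\<in>\<Omega>. \<bar>f w - f v\<bar> \<le> K * seq_dist w v powr \<alpha>)"

lemma agreement_props:
  assumes "w \<noteq> v"
  shows agreement_agree: "\<bar>n\<bar> < int (agreement w v) \<Longrightarrow> w n = v n"
    and agreement_ge: "(\<And>n. \<bar>n\<bar> < int N \<Longrightarrow> w n = v n) \<Longrightarrow> N \<le> agreement w v"
proof -
  let ?S = "{N. \<forall>n. \<bar>n\<bar> < int N \<longrightarrow> w n = v n}"
  obtain p where p: "w p \<noteq> v p" using assms by blast
  have "?S \<subseteq> {..nat \<bar>p\<bar>}"
  proof
    fix N assume "N \<in> ?S"
    with p have "\<not> \<bar>p\<bar> < int N" by auto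
    then show "N \<in> {..nat \<bar>p\<bar>}" by auto
  qed
  then have fin: "finite ?S" by (rule finite_subset) simp
  have "0 \<in> ?S" by simp
  then have "?S \<noteq> {}" by blast
  with fin have "Max ?S \<in> ?S" by (rule Max_in)
  then show "\<bar>n\<bar> < int (agreement w v) \<Longrightarrow> w n = v n"
    unfolding agreement_def by blast
  show "N \<le> agreement w v" if "\<And>n. \<bar>n\<bar> < int N \<Longrightarrow> w n = v n"
    unfolding agreement_def using fin that by (intro Max_ge) auto
qed

lemma seq_dist_ultrametric: "seq_dist w u \<le> max (seq_dist w v) (seq_dist v u)"
proof (cases "w = v \<or> v = u \<or> w = u")
  case True
  then show ?thesis by (auto simp: seq_dist_def max_def)
next
  case False
  then have ne: "w \<noteq> v" "v \<noteq> u" "w \<noteq> u" by auto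
  have "min (agreement w v) (agreement v u) \<le> agreement w u"
  proof (rule agreement_ge[OF ne(3)])
    fix n assume "\<bar>n\<bar> < int (min (agreement w v) (agreement v u))"
    then show "w n = u n"
      using agreement_agree[OF ne(1), of n] agreement_agree[OF ne(2), of n] by simp
  qed
  then show ?thesis using False by (auto simp: seq_dist_def min_def max_def split: if_splits)
qed

lemma Metric_space_seq_dist: "Metric_space \<Omega> seq_dist"
proof
  show nonneg: "0 \<le> seq_dist w v" for w v by (simp add: seq_dist_def)
  show "seq_dist w v = seq_dist v w" for w v
    by (simp add: seq_dist_def agreement_def eq_commute)
  show "seq_dist w v = 0 \<longleftrightarrow> w = v" for w v by (simp add: seq_dist_def)
  show "seq_dist w u \<le> seq_dist w v + seq_dist v u" for w v u
    using seq_dist_ultrametric[of w u v] nonneg[of w v] nonneg[of v u] by linarith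
qed

end

theory Submission
  imports Defs
begin

text \<open>Subtract the mean from \<open>f\<close>, so that \<open>f\<close> has integral zero, and write \<open>S n\<close> for its
  \<open>n\<close>-th Birkhoff sum. The proof is Chernoff's method for sums of blocks that are not independent
  but quasi-independent: two events that depend on disjoint consecutive windows of coordinates
  satisfy \<open>\<mu> (A \<inter> B) \<le> C * \<mu> A * \<mu> B\<close>, by bounded distortion.

  Three observations make this work. First, if two points agree on the coordinates in
  \<open>{0..<M}\<close>, then their values of \<open>S M\<close> differ by at most a constant \<open>D\<close> that does not depend on
  \<open>M\<close> (\<open>birkhoff_sum_bounded_variation\<close>). So up to \<open>D\<close> the sum over a block of length \<open>M\<close> is a
  function of that block alone. Second, expectations of products of nonnegative functions of
  consecutive blocks factorise up to one factor \<open>C\<close> per block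
  (\<open>integral_prod_blocks_le\<close>). With \<open>t = s / M\<close> this gives
  \<open>E (exp (t * S (q * M))) \<le> (C * exp (2 * D * t) * E (exp (s * S M / M))) ^ q\<close>
  (\<open>exp_moment_blocks_le\<close>). Third, \<open>S M / M\<close> tends to zero in probability by ergodicity, so for
  fixed \<open>s\<close> the last expectation is not much above \<open>exp (s * \<epsilon> / 2)\<close> when \<open>M\<close> is large, while
  Markov's inequality gains \<open>exp (- s * \<epsilon>)\<close> per block. The order of the choices is the point:
  \<open>s\<close> is taken so large that \<open>exp (s * \<epsilon> / 2)\<close> beats the distortion constant \<open>C\<close>, and \<open>M\<close> is
  taken large only afterwards. Every block then contributes a factor of at most one half
  (\<open>upper_large_deviation\<close>). The theorem follows by applying this to \<open>f\<close> and to \<open>- f\<close>.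

  The law of large numbers in probability is obtained from the statement that an observable of
  negative mean has almost surely bounded Birkhoff sums (\<open>AE_birkhoff_sum_bounded\<close>), a form of
  the maximal ergodic theorem.\<close>

section \<open>Birkhoff sums and a weak law of large numbers\<close>

definition birkhoff_sum :: "('a \<Rightarrow> 'a) \<Rightarrow> ('a \<Rightarrow> real) \<Rightarrow> nat \<Rightarrow> 'a \<Rightarrow> real" where
  "birkhoff_sum T f n w = (\<Sum>k<n. f ((T ^^ k) w))"

lemma birkhoff_sum_0 [simp]: "birkhoff_sum T f 0 w = 0"
  by (simp add: birkhoff_sum_def)

lemma birkhoff_sum_Suc_left: "birkhoff_sum T f (Suc n) w = f w + birkhoff_sum T f n (T w)"
  by (simp add: birkhoff_sum_def sum.lessThan_Suc_shift funpow_swap1 del: sum.lessThan_Suc)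

lemma birkhoff_sum_add:
  "birkhoff_sum T f (m + n) w = birkhoff_sum T f m w + birkhoff_sum T f n ((T ^^ m) w)"
  by (induction m arbitrary: w) (simp_all add: birkhoff_sum_Suc_left funpow_swap1)

lemma birkhoff_sum_mult:
  "birkhoff_sum T f (q * M) w = (\<Sum>j<q. birkhoff_sum T f M ((T ^^ (j * M)) w))"
  by (induction q) (simp_all add: birkhoff_sum_add add.commute[of M])

lemma birkhoff_sum_diff_const:
  "birkhoff_sum T (\<lambda>w. f w - c) n w = birkhoff_sum T f n w - real n * c"
  by (simp add: birkhoff_sum_def sum_subtractf)

lemma birkhoff_sum_uminus: "birkhoff_sum T (\<lambda>w. - f w) n w = - birkhoff_sum T f n w"
  by (simp add: birkhoff_sum_def sum_negf)

lemma funpow_invariant: "T \<in> S \<rightarrow> S \<Longrightarrow> w \<in> S \<Longrightarrow> (T ^^ k) w \<in> S"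
  by (induction k) auto

lemma birkhoff_sum_le:
  assumes "T \<in> S \<rightarrow> S" "\<And>w. w \<in> S \<Longrightarrow> f w \<le> B" "w \<in> S"
  shows "birkhoff_sum T f n w \<le> real n * B"
  using sum_bounded_above[of "{..<n}" "\<lambda>k. f ((T ^^ k) w)" B] assms funpow_invariant[of T S w]
  by (simp add: birkhoff_sum_def)

lemma measurable_birkhoff_sum:
  assumes [measurable]: "T \<in> measurable M M" "f \<in> borel_measurable M"
  shows "birkhoff_sum T f n \<in> borel_measurable M"
proof -
  have [measurable]: "(T ^^ k) \<in> measurable M M" for k by simp
  show ?thesis unfolding birkhoff_sum_def[abs_def] by measurable
qed

text \<open>This is the maximum of the Birkhoff sums of orders \<open>0\<close> to \<open>n\<close>. The recursion is used as the
  definition because the cocycle relation between \<open>w\<close> and \<open>T w\<close> is all that the maximal ergodic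
  argument needs.\<close>

primrec max_birkhoff :: "('a \<Rightarrow> 'a) \<Rightarrow> ('a \<Rightarrow> real) \<Rightarrow> nat \<Rightarrow> 'a \<Rightarrow> real" where
  "max_birkhoff T f 0 = (\<lambda>w. 0)"
| "max_birkhoff T f (Suc n) = (\<lambda>w. max 0 (f w + max_birkhoff T f n (T w)))"

lemma max_birkhoff_nonneg: "0 \<le> max_birkhoff T f n w"
  by (cases n) auto

lemma max_birkhoff_Suc_ge: "max_birkhoff T f n w \<le> max_birkhoff T f (Suc n) w"
proof (induction n arbitrary: w)
  case (Suc n)
  from Suc[of "T w"] show ?case
    unfolding max_birkhoff.simps(2)[of T f "Suc n"] max_birkhoff.simps(2)[of T f n]
    by (intro max.mono add_left_mono) auto
qed simp

lemma max_birkhoff_mono: "m \<le> n \<Longrightarrow> max_birkhoff T f m w \<le> max_birkhoff T f n w"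
  by (rule lift_Suc_mono_le[of "\<lambda>n. max_birkhoff T f n w"]) (rule max_birkhoff_Suc_ge)

lemma birkhoff_sum_le_max: "birkhoff_sum T f n w \<le> max_birkhoff T f n w"
proof (induction n arbitrary: w)
  case (Suc n)
  from Suc[of "T w"] show ?case by (simp add: birkhoff_sum_Suc_left)
qed simp

lemma integral_comp_invariant:
  assumes "T \<in> measurable M M" "distr M M T = M" "g \<in> borel_measurable M"
  shows "(\<integral>w. g (T w) \<partial>M) = (\<integral>w. (g w :: real) \<partial>M)"
  using integral_distr[of T M M g] assms by simp

lemma integrable_comp_invariant:
  assumes "T \<in> measurable M M" "distr M M T = M" "integrable M (g :: 'a \<Rightarrow> real)"
  shows "integrable M (\<lambda>w. g (T w))"
  using integrable_distr[of T M M g] assms by simp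

lemma integrable_max_birkhoff:
  assumes T: "T \<in> measurable M M" "distr M M T = M" and f: "integrable M f"
  shows "integrable M (max_birkhoff T f n)"
proof (induction n)
  case (Suc n)
  from integrable_comp_invariant[OF T Suc] f show ?case by simp
qed simp

text \<open>Let \<open>F n\<close> be the maximal Birkhoff sum. The set \<open>A\<close> where \<open>F n\<close> is unbounded in \<open>n\<close> is
  invariant, so it has measure zero or one. On \<open>A\<close> the difference \<open>F (Suc n) - F n \<circ> T\<close> is
  eventually equal to \<open>f\<close>, it is always dominated by \<open>\<bar>f\<bar>\<close>, and its integral over \<open>A\<close> equals
  that of \<open>F (Suc n) - F n \<ge> 0\<close>. Hence \<open>f\<close> has nonnegative integral over \<open>A\<close>, so \<open>A\<close> cannot
  have measure one.\<close>

lemma (in prob_space) AE_birkhoff_sum_bounded: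
  assumes erg: "ergodic M T" and f: "integrable M f" and neg: "(\<integral>w. f w \<partial>M) < 0"
  shows "AE w in M. \<exists>c. \<forall>n. birkhoff_sum T f n w \<le> c"
proof -
  define F where "F = max_birkhoff T f"
  have T [measurable]: "T \<in> measurable M M" and inv: "distr M M T = M"
    using erg by (auto simp: ergodic_def)
  have F_int: "integrable M (F n)" for n
    unfolding F_def by (rule integrable_max_birkhoff[OF T inv f])
  have [measurable]: "F n \<in> borel_measurable M" "f \<in> borel_measurable M" for n
    using F_int f by auto
  have F_Suc: "F (Suc n) w = max 0 (f w + F n (T w))" and F0: "0 \<le> F n w" for n w
    by (simp_all add: F_def max_birkhoff_nonneg)
  \<comment> \<open>Natural thresholds make this a countable intersection, hence measurable.\<close>
  define A where "A = {w \<in> space M. \<forall>c::nat. \<exists>n. F n w > real c}"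
  have A [measurable]: "A \<in> sets M" unfolding A_def by measurable
  have A_iff: "w \<in> A \<longleftrightarrow> w \<in> space M \<and> (\<forall>c. \<exists>n. F n w > c)" for w
    unfolding A_def by (auto, meson less_le_trans reals_Archimedean2 less_trans)
  have A_T: "T w \<in> A \<longleftrightarrow> w \<in> A" if w: "w \<in> space M" for w
  proof -
    have Tw: "T w \<in> space M" using measurable_space[OF T w] .
    show ?thesis
    proof
      assume a: "T w \<in> A"
      have "\<exists>n. F n w > c" for c
      proof -
        obtain n where "F n (T w) > c - f w" using a by (auto simp: A_iff)
        then have "F (Suc n) w > c" using F_Suc[of n w] by auto
        then show ?thesis ..
      qed
      then show "w \<in> A" using w by (simp add: A_iff)
    next
      assume a: "w \<in> A"
      have "\<exists>n. F n (T w) > c" for c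
      proof -
        obtain n where n: "F n w > max 0 (c + f w)" using a unfolding A_iff by blast
        then obtain m where "n = Suc m" by (cases n) (auto simp: F_def)
        with n have "F m (T w) > c" using F_Suc[of m w] by auto
        then show ?thesis ..
      qed
      then show "T w \<in> A" using Tw by (simp add: A_iff)
    qed
  qed
  have "T -` A \<inter> space M = A" using A_T by (auto simp: A_iff)
  then have cases: "measure M A = 0 \<or> measure M A = 1"
    using erg A by (auto simp: ergodic_def)
  define g where "g n w = indicat_real A w * (F (Suc n) w - F n (T w))" for n w
  have g_abs: "\<bar>g n w\<bar> \<le> \<bar>f w\<bar>" for n w
    using F_Suc[of n w] F0[of n "T w"] by (auto simp: g_def indicator_def)
  have g_nonneg: "0 \<le> (\<integral>w. g n w \<partial>M)" for n
  proof -
    have AF: "integrable M (\<lambda>w. indicat_real A w * F n w)" for n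
      using integrable_mult_indicator[OF A F_int[of n]] by simp
    have AFT: "integrable M (\<lambda>w. indicat_real A (T w) * F n (T w))" for n
      by (rule integrable_comp_invariant[OF T inv AF])
    have "(\<integral>w. g n w \<partial>M)
        = (\<integral>w. indicat_real A w * F (Suc n) w - indicat_real A (T w) * F n (T w) \<partial>M)"
      by (rule Bochner_Integration.integral_cong)
        (auto simp: g_def A_T indicator_def split: if_splits)
    also have "\<dots> = (\<integral>w. indicat_real A w * F (Suc n) w \<partial>M) - (\<integral>w. indicat_real A w * F n w \<partial>M)"
      using integral_comp_invariant[OF T inv, of "\<lambda>w. indicat_real A w * F n w"]
      by (simp add: AF AFT)
    also have "\<dots> \<ge> 0"
      using max_birkhoff_Suc_ge[of T f n]
      by (simp add: F_def [symmetric] del: max_birkhoff.simps)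
        (intro integral_mono AF, auto simp: indicator_def)
    finally show ?thesis .
  qed
  have g_lim: "(\<lambda>n. g n w) \<longlonglongrightarrow> indicat_real A w * f w" if w: "w \<in> space M" for w
  proof (cases "w \<in> A")
    case True
    then have "T w \<in> A" using A_T w by simp
    then obtain m where m: "F m (T w) > - f w" by (auto simp: A_iff)
    have "g n w = indicat_real A w * f w" if "n \<ge> m" for n
    proof -
      have "F n (T w) > - f w"
        using m max_birkhoff_mono[OF that, of T f "T w"] by (simp add: F_def)
      then show ?thesis using F_Suc[of n w] by (simp add: g_def)
    qed
    then have "eventually (\<lambda>n. g n w = indicat_real A w * f w) sequentially"
      unfolding eventually_sequentially by blast
    then show ?thesis by (rule tendsto_eventually)
  qed (simp add: g_def)
  have "(\<lambda>n. \<integral>w. g n w \<partial>M) \<longlonglongrightarrow> (\<integral>w. indicat_real A w * f w \<partial>M)"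
  proof (rule integral_dominated_convergence[where w = "\<lambda>w. \<bar>f w\<bar>"])
    show "g n \<in> borel_measurable M" for n unfolding g_def[abs_def] by measurable
  qed (use f g_lim g_abs in auto)
  then have ge: "0 \<le> (\<integral>w. indicat_real A w * f w \<partial>M)"
    by (rule LIMSEQ_le_const) (use g_nonneg in auto)
  have "measure M A \<noteq> 1"
  proof
    assume "measure M A = 1"
    then have "AE w in M. w \<in> A" using prob_eq_1[OF A] by simp
    then have "AE w in M. indicat_real A w * f w = f w" by eventually_elim simp
    then have "(\<integral>w. indicat_real A w * f w \<partial>M) = (\<integral>w. f w \<partial>M)"
      by (rule integral_cong_AE[rotated 2]) auto
    with ge neg show False by simp
  qed
  with cases have "AE w in M. w \<notin> A" using prob_eq_0[OF A] by simp
  with AE_space show ?thesis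
  proof eventually_elim
    case (elim w)
    then obtain c where "F n w \<le> c" for n by (auto simp: A_iff not_less)
    then have "birkhoff_sum T f n w \<le> c" for n
      using birkhoff_sum_le_max[of T f n w] order_trans by (fastforce simp: F_def)
    then show ?case by blast
  qed
qed

text \<open>The function \<open>f - e / 2\<close> has negative mean, so its Birkhoff sums are almost surely bounded by
  some \<open>c\<close>. Almost every point therefore leaves the exceptional sets once
  \<open>n * e / 2\<close> exceeds \<open>c\<close>.\<close>

lemma (in prob_space) prob_birkhoff_sum_tendsto_0:
  assumes erg: "ergodic M T" and f: "integrable M f"
    and mean: "(\<integral>w. f w \<partial>M) = 0" and e: "e > 0"
  shows "(\<lambda>n. prob {w \<in> space M. birkhoff_sum T f n w \<ge> e * real n}) \<longlonglongrightarrow> 0"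
proof -
  have T [measurable]: "T \<in> measurable M M"
    using erg by (auto simp: ergodic_def)
  have fm: "f \<in> borel_measurable M" using f by auto
  note [measurable] = measurable_birkhoff_sum[OF T fm]
  define E where "E n = {w \<in> space M. birkhoff_sum T f n w \<ge> e * real n}" for n
  have [measurable]: "E n \<in> sets M" for n unfolding E_def by measurable
  have "(\<integral>w. f w - e / 2 \<partial>M) < 0"
    using f mean e by (simp add: prob_space)
  then have "AE w in M. \<exists>c. \<forall>n. birkhoff_sum T (\<lambda>w. f w - e / 2) n w \<le> c"
    using f by (intro AE_birkhoff_sum_bounded[OF erg]) auto
  then have lim: "AE w in M. (\<lambda>n. indicat_real (E n) w) \<longlonglongrightarrow> 0"
  proof eventually_elim
    case (elim w)
    then obtain c where c: "birkhoff_sum T f n w - real n * (e / 2) \<le> c" for n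
      by (auto simp: birkhoff_sum_diff_const)
    have "eventually (\<lambda>n. real n > 2 * c / e) sequentially"
      using filterlim_real_sequentially by (auto simp: filterlim_at_top_dense)
    then have "eventually (\<lambda>n. indicat_real (E n) w = 0) sequentially"
    proof eventually_elim
      case (elim n)
      then have "c < real n * (e / 2)" using e by (simp add: field_simps)
      then have "birkhoff_sum T f n w < e * real n" using c[of n] by (simp add: field_simps)
      then show ?case by (simp add: E_def)
    qed
    then show ?case by (rule tendsto_eventually)
  qed
  have "(\<lambda>n. \<integral>w. indicat_real (E n) w \<partial>M) \<longlonglongrightarrow> (\<integral>w. 0 \<partial>M)"
    by (rule integral_dominated_convergence[where w = "\<lambda>_. 1"])
      (use lim in \<open>auto simp: indicator_def\<close>)
  then show ?thesis by (simp add: E_def)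
qed

lemma (in prob_space) integral_sum_indicator:
  assumes "\<And>i. i \<in> I \<Longrightarrow> A i \<in> sets M"
  shows "(\<integral>w. (\<Sum>i\<in>I. x i * indicator (A i) w) \<partial>M) = (\<Sum>i\<in>I. x i * prob (A i))"
proof -
  have int: "integrable M (\<lambda>w. x i * indicat_real (A i) w)" if "i \<in> I" for i
    using assms[OF that] by (simp add: emeasure_eq_measure)
  have "(\<integral>w. (\<Sum>i\<in>I. x i * indicator (A i) w) \<partial>M) = (\<Sum>i\<in>I. \<integral>w. x i * indicat_real (A i) w \<partial>M)"
    by (rule Bochner_Integration.integral_sum) (rule int)
  also have "\<dots> = (\<Sum>i\<in>I. x i * prob (A i))"
    by (intro sum.cong refl) (simp add: assms sets.Int_space_eq2)
  finally show ?thesis .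
qed

section \<open>Functions of finitely many coordinates\<close>

text \<open>The window is half-open and is given by its end points, and the prescribed word is read off
  from a point. Consecutive windows then share an end point, and the window \<open>{a..<a}\<close> is allowed:
  it gives the whole space.\<close>

definition window_cylinder :: "(int \<Rightarrow> nat) set \<Rightarrow> int \<Rightarrow> int \<Rightarrow> (int \<Rightarrow> nat) \<Rightarrow> (int \<Rightarrow> nat) set" where
  "window_cylinder \<Omega> a b w = {v \<in> \<Omega>. \<forall>i\<in>{a..<b}. v i = w i}"

definition determined_on :: "(int \<Rightarrow> nat) set \<Rightarrow> int \<Rightarrow> int \<Rightarrow> ((int \<Rightarrow> nat) \<Rightarrow> real) \<Rightarrow> bool" where
  "determined_on \<Omega> a b h \<longleftrightarrow>
     (\<forall>w\<in>\<Omega>. \<forall>v\<in>\<Omega>. (\<forall>i\<in>{a..<b}. w i = v i) \<longrightarrow> h w = h v)"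

lemma window_cylinder_eq_cylinder:
  assumes "a < b"
  shows "window_cylinder \<Omega> a b w = cylinder \<Omega> a (nat (b - a) - 1) (\<lambda>i. w (a + int i))"
proof -
  have "(\<forall>i\<in>{a..<b}. v i = w i) \<longleftrightarrow> (\<forall>i\<le>nat (b - a) - 1. v (a + int i) = w (a + int i))"
    (is "?l \<longleftrightarrow> ?r") for v
  proof
    assume ?r
    show ?l
    proof
      fix i assume i: "i \<in> {a..<b}"
      then have "nat (i - a) \<le> nat (b - a) - 1" by auto
      with \<open>?r\<close> have "v (a + int (nat (i - a))) = w (a + int (nat (i - a)))" by blast
      with i show "v i = w i" by simp
    qed
  qed (use assms in auto)
  then show ?thesis by (simp add: window_cylinder_def cylinder_def)
qed

lemma self_in_window_cylinder: "w \<in> \<Omega> \<Longrightarrow> w \<in> window_cylinder \<Omega> a b w"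
  by (simp add: window_cylinder_def)

lemma window_cylinder_eqI: "v \<in> window_cylinder \<Omega> a b w \<Longrightarrow> window_cylinder \<Omega> a b v = window_cylinder \<Omega> a b w"
  by (auto simp: window_cylinder_def)

lemma window_cylinder_cong:
  "(\<And>i. i \<in> {a..<b} \<Longrightarrow> w i = v i) \<Longrightarrow> window_cylinder \<Omega> a b w = window_cylinder \<Omega> a b v"
  by (auto simp: window_cylinder_def)

lemma finite_window_cylinders:
  assumes "\<Omega> \<subseteq> full_shift l"
  shows "finite (window_cylinder \<Omega> a b ` \<Omega>)"
proof -
  let ?E = "PiE {a..<b} (\<lambda>_. {1..l})"
  have "window_cylinder \<Omega> a b ` \<Omega> \<subseteq> window_cylinder \<Omega> a b ` ?E"
  proof
    fix Z assume "Z \<in> window_cylinder \<Omega> a b ` \<Omega>"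
    then obtain w where w: "w \<in> \<Omega>" "Z = window_cylinder \<Omega> a b w" by blast
    have "restrict w {a..<b} \<in> ?E" using w assms by (auto simp: full_shift_def)
    moreover have "Z = window_cylinder \<Omega> a b (restrict w {a..<b})"
      unfolding w by (rule window_cylinder_cong) simp
    ultimately show "Z \<in> window_cylinder \<Omega> a b ` ?E" by blast
  qed
  moreover have "finite ?E" by (intro finite_PiE) auto
  ultimately show ?thesis by (rule finite_surj[rotated])
qed

lemma determined_on_expansion:
  assumes sub: "\<Omega> \<subseteq> full_shift l" and det: "determined_on \<Omega> a b h" and w: "w \<in> \<Omega>"
  shows "h w = (\<Sum>Z\<in>window_cylinder \<Omega> a b ` \<Omega>. h (SOME v. v \<in> Z) * indicator Z w)"
proof -
  let ?P = "window_cylinder \<Omega> a b ` \<Omega>" and ?W = "window_cylinder \<Omega> a b w"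
  have "w \<in> Z \<longleftrightarrow> Z = ?W" if "Z \<in> ?P" for Z
    using that window_cylinder_eqI[of w \<Omega> a b] self_in_window_cylinder[OF w] by auto
  then have "(\<Sum>Z\<in>?P. h (SOME v. v \<in> Z) * indicator Z w)
      = (\<Sum>Z\<in>?P. if Z = ?W then h (SOME v. v \<in> ?W) else 0)"
    by (intro sum.cong) (auto simp: indicator_def)
  also have "\<dots> = h (SOME v. v \<in> ?W)"
    using w finite_window_cylinders[OF sub] by simp
  also have "(SOME v. v \<in> ?W) \<in> ?W"
    by (rule someI[of "\<lambda>v. v \<in> ?W"]) (rule self_in_window_cylinder[OF w])
  then have "h (SOME v. v \<in> ?W) = h w"
    using det w unfolding determined_on_def window_cylinder_def by blast
  finally show ?thesis by (rule sym)
qed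

text \<open>Evaluating a function at a chosen point of the cylinder of \<open>w\<close> turns it into a function of
  finitely many coordinates. This is how Hoelder observables and their block sums are
  approximated below.\<close>

lemma determined_on_representative:
  "determined_on \<Omega> a b (\<lambda>w. h (SOME v. v \<in> window_cylinder \<Omega> a b w))"
  unfolding determined_on_def by (auto intro!: arg_cong[of _ _ h] simp: window_cylinder_def)

lemma representative_in_window_cylinder:
  "w \<in> \<Omega> \<Longrightarrow> (SOME v. v \<in> window_cylinder \<Omega> a b w) \<in> window_cylinder \<Omega> a b w"
  by (rule someI[of "\<lambda>v. v \<in> window_cylinder \<Omega> a b w"]) (rule self_in_window_cylinder)

lemma seq_dist_le:
  assumes "\<And>n. \<bar>n\<bar> < int N \<Longrightarrow> w n = v n"
  shows "seq_dist w v \<le> exp (- real N)"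
  using agreement_ge[of w v N] assms by (auto simp: seq_dist_def)

lemma openin_window_cylinder: "openin (seq_topology \<Omega>) (window_cylinder \<Omega> a b w)"
proof -
  interpret Metric_space \<Omega> seq_dist by (rule Metric_space_seq_dist)
  define N where "N = nat \<bar>a\<bar> + nat \<bar>b\<bar>"
  have "mball u (exp (- real N)) \<subseteq> window_cylinder \<Omega> a b w" if u: "u \<in> window_cylinder \<Omega> a b w" for u
  proof
    fix v assume "v \<in> mball u (exp (- real N))"
    then have v: "v \<in> \<Omega>" "seq_dist u v < exp (- real N)" by auto
    have "u i = v i" if "i \<in> {a..<b}" for i
    proof (cases "u = v")
      case False
      with v have "N < agreement u v" by (simp add: seq_dist_def)
      then show ?thesis
        using agreement_agree[OF False, of i] that by (auto simp: N_def)
    qed simp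
    then show "v \<in> window_cylinder \<Omega> a b w" using u v by (auto simp: window_cylinder_def)
  qed
  moreover have "window_cylinder \<Omega> a b w \<subseteq> \<Omega>" by (auto simp: window_cylinder_def)
  ultimately show ?thesis unfolding openin_mtopology by (meson exp_gt_zero)
qed

lemma funpow_shift: "(shift ^^ k) w n = w (n + int k)"
  by (induction k arbitrary: n) (simp_all add: shift_def algebra_simps)

lemma space_seq_borel: "space (seq_borel \<Omega>) = \<Omega>"
  by (simp add: seq_borel_def space_measure_of_conv)

lemma sets_seq_borel_openin:
  assumes "openin (seq_topology \<Omega>) U"
  shows "U \<in> sets (seq_borel \<Omega>)"
proof -
  interpret Metric_space \<Omega> seq_dist by (rule Metric_space_seq_dist)
  have "{U. openin (seq_topology \<Omega>) U} \<subseteq> Pow \<Omega>"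
    using openin_subset by fastforce
  then show ?thesis unfolding seq_borel_def using assms by auto
qed

section \<open>Shifts with an upper distortion bound\<close>

text \<open>The case \<open>a = b\<close> of the distortion inequality, where the first cylinder is the whole space,
  is included so that products over blocks can be handled by induction from the empty product.\<close>

locale quasi_independent_shift = prob_space \<mu> for \<mu> :: "(int \<Rightarrow> nat) measure" +
  fixes \<Omega> :: "(int \<Rightarrow> nat) set" and l :: nat and C :: real
  assumes sets_eq: "sets \<mu> = sets (seq_borel \<Omega>)"
    and sub: "\<Omega> \<subseteq> full_shift l"
    and erg: "ergodic \<mu> shift"
    and C_ge_1: "C \<ge> 1"
    and distortion: "\<And>a b c w v. a \<le> b \<Longrightarrow> b < c \<Longrightarrow>
      measure \<mu> (window_cylinder \<Omega> a b w \<inter> window_cylinder \<Omega> b c v)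
        \<le> C * (measure \<mu> (window_cylinder \<Omega> a b w) * measure \<mu> (window_cylinder \<Omega> b c v))"
begin

lemma space_eq: "space \<mu> = \<Omega>"
  using sets_eq_imp_space_eq[OF sets_eq] by (simp add: space_seq_borel)

lemma shift_measurable [measurable]: "shift \<in> measurable \<mu> \<mu>" and shift_invariant: "distr \<mu> \<mu> shift = \<mu>"
  using erg by (auto simp: ergodic_def)

lemma shift_closed: "shift \<in> \<Omega> \<rightarrow> \<Omega>"
  using measurable_space[OF shift_measurable] by (auto simp: space_eq)

lemma funpow_shift_closed: "w \<in> \<Omega> \<Longrightarrow> (shift ^^ k) w \<in> \<Omega>"
  using funpow_invariant[OF shift_closed] .

lemma sets_window_cylinder [measurable]: "window_cylinder \<Omega> a b w \<in> sets \<mu>"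
  unfolding sets_eq by (rule sets_seq_borel_openin) (rule openin_window_cylinder)

lemma determined_on_measurable:
  assumes "determined_on \<Omega> a b h"
  shows "h \<in> borel_measurable \<mu>"
proof -
  have "(\<lambda>w. \<Sum>Z\<in>window_cylinder \<Omega> a b ` \<Omega>. h (SOME v. v \<in> Z) * indicator Z w) \<in> borel_measurable \<mu>"
    by (intro borel_measurable_sum borel_measurable_times) auto
  then show ?thesis
    by (rule measurable_cong[THEN iffD1, rotated])
      (rule determined_on_expansion[OF sub assms, symmetric], simp add: space_eq)
qed

lemma determined_on_integrable:
  assumes "determined_on \<Omega> a b h"
  shows "integrable \<mu> h"
proof -
  have "integrable \<mu> (\<lambda>w. \<Sum>Z\<in>window_cylinder \<Omega> a b ` \<Omega>. h (SOME v. v \<in> Z) * indicator Z w)"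
    by (intro Bochner_Integration.integrable_sum integrable_mult_right integrable_real_indicator)
      (auto simp: emeasure_eq_measure)
  then show ?thesis
    by (rule Bochner_Integration.integrable_cong[THEN iffD1, rotated 2])
      (rule refl, rule determined_on_expansion[OF sub assms, symmetric], simp add: space_eq)
qed

lemma integral_funpow_shift:
  assumes "h \<in> borel_measurable \<mu>"
  shows "(\<integral>w. h ((shift ^^ k) w) \<partial>\<mu>) = (\<integral>w. (h w :: real) \<partial>\<mu>)"
proof (induction k)
  case (Suc k)
  have [measurable]: "(shift ^^ k) \<in> measurable \<mu> \<mu>" by simp
  note [measurable] = assms
  have "(\<lambda>w. h ((shift ^^ k) w)) \<in> borel_measurable \<mu>" by measurable
  from integral_comp_invariant[OF shift_measurable shift_invariant this] Suc
  show ?case by (simp add: funpow_swap1)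
qed simp

text \<open>Both functions are linear combinations of indicators of cylinders with nonnegative
  coefficients, so the distortion inequality for cylinders extends bilinearly.\<close>

lemma integral_mult_le:
  assumes le: "a \<le> b" "b < c"
    and det: "determined_on \<Omega> a b g" "determined_on \<Omega> b c h"
    and nonneg: "\<And>w. w \<in> \<Omega> \<Longrightarrow> 0 \<le> g w" "\<And>w. w \<in> \<Omega> \<Longrightarrow> 0 \<le> h w"
  shows "(\<integral>w. g w * h w \<partial>\<mu>) \<le> C * ((\<integral>w. g w \<partial>\<mu>) * (\<integral>w. h w \<partial>\<mu>))"
proof -
  define P where "P = window_cylinder \<Omega> a b ` \<Omega>"
  define Q where "Q = window_cylinder \<Omega> b c ` \<Omega>"
  define x where "x Z = g (SOME v. v \<in> Z)" for Z
  define y where "y Z = h (SOME v. v \<in> Z)" for Z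
  have exp_g: "g w = (\<Sum>Z\<in>P. x Z * indicator Z w)" and exp_h: "h w = (\<Sum>Z\<in>Q. y Z * indicator Z w)"
    if "w \<in> \<Omega>" for w
    using determined_on_expansion[OF sub det(1) that] determined_on_expansion[OF sub det(2) that]
    by (simp_all add: P_def Q_def x_def y_def)
  have sets [measurable]: "Z \<in> P \<Longrightarrow> Z \<in> sets \<mu>" "Z \<in> Q \<Longrightarrow> Z \<in> sets \<mu>" for Z
    by (auto simp: P_def Q_def)
  have rep_in_Omega: "(SOME v. v \<in> window_cylinder \<Omega> a' b' w) \<in> \<Omega>" if "w \<in> \<Omega>" for a' b' w
    using representative_in_window_cylinder[OF that, of a' b'] by (metis (no_types, lifting) mem_Collect_eq window_cylinder_def)
  have x0: "0 \<le> x Z" if "Z \<in> P" for Z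
    unfolding x_def using that rep_in_Omega by (intro nonneg) (auto simp: P_def)
  have y0: "0 \<le> y Z" if "Z \<in> Q" for Z
    unfolding y_def using that rep_in_Omega by (intro nonneg) (auto simp: Q_def)
  have int_g: "(\<integral>w. g w \<partial>\<mu>) = (\<Sum>Z\<in>P. x Z * measure \<mu> Z)"
    by (subst integral_sum_indicator[symmetric], fact sets(1))
      (intro Bochner_Integration.integral_cong refl exp_g, simp add: space_eq)
  have int_h: "(\<integral>w. h w \<partial>\<mu>) = (\<Sum>Z\<in>Q. y Z * measure \<mu> Z)"
    by (subst integral_sum_indicator[symmetric], fact sets(2))
      (intro Bochner_Integration.integral_cong refl exp_h, simp add: space_eq)
  have "(\<integral>w. g w * h w \<partial>\<mu>)
      = (\<integral>w. (\<Sum>p\<in>P \<times> Q. x (fst p) * y (snd p) * indicator (fst p \<inter> snd p) w) \<partial>\<mu>)"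
    by (intro Bochner_Integration.integral_cong refl)
      (simp add: space_eq exp_g exp_h sum_product sum.cartesian_product case_prod_beta
        indicator_inter_arith mult_ac)
  also have "\<dots> = (\<Sum>p\<in>P \<times> Q. x (fst p) * y (snd p) * measure \<mu> (fst p \<inter> snd p))"
    by (rule integral_sum_indicator) (auto intro: sets)
  also have "\<dots> = (\<Sum>Z\<in>P. \<Sum>Y\<in>Q. x Z * y Y * measure \<mu> (Z \<inter> Y))"
    by (simp add: sum.cartesian_product case_prod_beta)
  also have "\<dots> \<le> (\<Sum>Z\<in>P. \<Sum>Y\<in>Q. x Z * y Y * (C * (measure \<mu> Z * measure \<mu> Y)))"
    by (intro sum_mono mult_left_mono mult_nonneg_nonneg x0 y0)
      (auto simp: P_def Q_def intro!: distortion le)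
  also have "\<dots> = C * ((\<integral>w. g w \<partial>\<mu>) * (\<integral>w. h w \<partial>\<mu>))"
    unfolding int_g int_h sum_product by (simp add: sum_distrib_left mult_ac)
  finally show ?thesis .
qed

lemma determined_on_funpow_shift:
  assumes "determined_on \<Omega> a b g"
  shows "determined_on \<Omega> (a + int k) (b + int k) (\<lambda>w. g ((shift ^^ k) w))"
  unfolding determined_on_def
proof (intro ballI impI)
  fix w v assume wv: "w \<in> \<Omega>" "v \<in> \<Omega>" and eq: "\<forall>i\<in>{a + int k..<b + int k}. w i = v i"
  have "\<forall>i\<in>{a..<b}. (shift ^^ k) w i = (shift ^^ k) v i"
    using eq by (auto simp: funpow_shift)
  with assms wv show "g ((shift ^^ k) w) = g ((shift ^^ k) v)"
    unfolding determined_on_def using funpow_shift_closed by blast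
qed

lemma determined_on_mono:
  "determined_on \<Omega> a b g \<Longrightarrow> a' \<le> a \<Longrightarrow> b \<le> b' \<Longrightarrow> determined_on \<Omega> a' b' g"
  unfolding determined_on_def by (meson atLeastLessThan_iff order_trans less_le_trans)

lemma integral_prod_blocks_le:
  assumes det: "determined_on \<Omega> 0 (int M) g" and M: "M \<ge> 1"
    and nonneg: "\<And>w. w \<in> \<Omega> \<Longrightarrow> 0 \<le> g w"
  shows "(\<integral>w. (\<Prod>j<q. g ((shift ^^ (j * M)) w)) \<partial>\<mu>) \<le> (C * (\<integral>w. g w \<partial>\<mu>)) ^ q"
proof (induction q)
  case (Suc q)
  let ?G = "\<lambda>w. \<Prod>j<q. g ((shift ^^ (j * M)) w)"
  let ?h = "\<lambda>w. g ((shift ^^ (q * M)) w)"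
  have block: "determined_on \<Omega> (int (j * M)) (int (Suc j * M)) (\<lambda>w. g ((shift ^^ (j * M)) w))" for j
    using determined_on_funpow_shift[OF det, of "j * M"] by (simp add: add.commute)
  have dG: "determined_on \<Omega> 0 (int (q * M)) ?G"
    unfolding determined_on_def
  proof (intro ballI impI prod.cong refl)
    fix w v j assume wv: "w \<in> \<Omega>" "v \<in> \<Omega>" "\<forall>i\<in>{0..<int (q * M)}. w i = v i" and "j \<in> {..<q}"
    then have "Suc j * M \<le> q * M" by (intro mult_right_mono) auto
    then have "determined_on \<Omega> 0 (int (q * M)) (\<lambda>w. g ((shift ^^ (j * M)) w))"
      by (intro determined_on_mono[OF block]) (simp_all only: of_nat_le_iff of_nat_0_le_iff)
    with wv show "g ((shift ^^ (j * M)) w) = g ((shift ^^ (j * M)) v)"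
      unfolding determined_on_def by blast
  qed
  have g_int: "0 \<le> (\<integral>w. g w \<partial>\<mu>)"
    by (rule integral_nonneg_AE) (auto intro!: AE_I2 nonneg simp: space_eq)
  have "(\<integral>w. (\<Prod>j<Suc q. g ((shift ^^ (j * M)) w)) \<partial>\<mu>) = (\<integral>w. ?G w * ?h w \<partial>\<mu>)"
    by simp
  also have "\<dots> \<le> C * ((\<integral>w. ?G w \<partial>\<mu>) * (\<integral>w. ?h w \<partial>\<mu>))"
  proof (rule integral_mult_le[OF _ _ dG block])
    show "int (q * M) < int (Suc q * M)" using M by simp
  qed (auto intro!: prod_nonneg nonneg funpow_shift_closed)
  also have "(\<integral>w. ?h w \<partial>\<mu>) = (\<integral>w. g w \<partial>\<mu>)"
    by (rule integral_funpow_shift[OF determined_on_measurable[OF det]])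
  also have "C * ((\<integral>w. ?G w \<partial>\<mu>) * (\<integral>w. g w \<partial>\<mu>)) \<le> C * ((C * (\<integral>w. g w \<partial>\<mu>)) ^ q * (\<integral>w. g w \<partial>\<mu>))"
    using Suc C_ge_1 g_int by (intro mult_left_mono mult_right_mono) auto
  also have "\<dots> = (C * (\<integral>w. g w \<partial>\<mu>)) ^ Suc q" by simp
  finally show ?case .
qed (simp add: prob_space)

end

section \<open>Hoelder observables\<close>

lemma seq_dist_nonneg: "0 \<le> seq_dist w v"
  by (simp add: seq_dist_def)

lemma hoelder_agree_bound:
  assumes hoelder: "\<And>w v. w \<in> \<Omega> \<Longrightarrow> v \<in> \<Omega> \<Longrightarrow> \<bar>f w - f v\<bar> \<le> K * seq_dist w v powr \<alpha>"
    and K: "K \<ge> 0" and \<alpha>: "\<alpha> > 0" and wv: "w \<in> \<Omega>" "v \<in> \<Omega>"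
    and agree: "\<And>n. \<bar>n\<bar> < int N \<Longrightarrow> w n = v n"
  shows "\<bar>f w - f v\<bar> \<le> K * exp (- \<alpha>) ^ N"
proof -
  have "seq_dist w v powr \<alpha> \<le> exp (- real N) powr \<alpha>"
  proof (rule powr_mono2)
    show "seq_dist w v \<le> exp (- real N)" by (rule seq_dist_le) (rule agree)
  qed (use \<alpha> seq_dist_nonneg in simp_all)
  also have "\<dots> = exp (- \<alpha>) ^ N"
    unfolding exp_of_nat_mult[symmetric] by (simp add: powr_def)
  finally have "K * seq_dist w v powr \<alpha> \<le> K * exp (- \<alpha>) ^ N"
    using K by (rule mult_left_mono)
  with hoelder[OF wv] show ?thesis by (rule order_trans)
qed

text \<open>If \<open>w\<close> and \<open>v\<close> agree on \<open>{0..<M}\<close>, their \<open>k\<close>-th shifts agree at all distances from the origin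
  smaller than the distance of \<open>k\<close> to the ends of the window. By Hoelder continuity the terms of
  the two Birkhoff sums differ by amounts that decay geometrically away from both ends of the
  window, so the total is at most twice a geometric series.\<close>

lemma birkhoff_sum_bounded_variation:
  assumes hoelder: "\<And>w v. w \<in> \<Omega> \<Longrightarrow> v \<in> \<Omega> \<Longrightarrow> \<bar>f w - f v\<bar> \<le> K * seq_dist w v powr \<alpha>"
    and K: "K \<ge> 0" and \<alpha>: "\<alpha> > 0" and closed: "shift \<in> \<Omega> \<rightarrow> \<Omega>"
    and wv: "w \<in> \<Omega>" "v \<in> \<Omega>" and agree: "\<forall>i\<in>{0..<int M}. w i = v i"
  shows "birkhoff_sum shift f M w \<le> birkhoff_sum shift f M v + 2 * K / (1 - exp (- \<alpha>))"
proof -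
  define r where "r = exp (- \<alpha>)"
  have r: "0 \<le> r" "r < 1" using \<alpha> by (auto simp: r_def)
  have geometric: "(\<Sum>k<M. r ^ k) \<le> 1 / (1 - r)"
    using r sum_gp_strict[of r M] by (simp add: divide_right_mono)
  have "f ((shift ^^ k) w) - f ((shift ^^ k) v) \<le> K * (r ^ k + r ^ (M - Suc k))" if "k < M" for k
  proof -
    define N where "N = min k (M - Suc k)"
    have "\<bar>f ((shift ^^ k) w) - f ((shift ^^ k) v)\<bar> \<le> K * exp (- \<alpha>) ^ N"
    proof (rule hoelder_agree_bound[OF hoelder K \<alpha>])
      fix n :: int assume "\<bar>n\<bar> < int N"
      then have "n + int k \<in> {0..<int M}" using that by (auto simp: N_def)
      then show "(shift ^^ k) w n = (shift ^^ k) v n" using agree by (simp add: funpow_shift)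
    qed (use wv funpow_invariant[OF closed] in auto)
    also have "exp (- \<alpha>) ^ N \<le> r ^ k + r ^ (M - Suc k)"
      using r by (auto simp: N_def r_def min_def)
    finally show ?thesis using K by (simp add: mult_left_mono)
  qed
  then have "(\<Sum>k<M. f ((shift ^^ k) w) - f ((shift ^^ k) v)) \<le> (\<Sum>k<M. K * (r ^ k + r ^ (M - Suc k)))"
    by (intro sum_mono) auto
  also have "\<dots> = K * (2 * (\<Sum>k<M. r ^ k))"
    by (simp add: sum_distrib_left[symmetric] sum.distrib sum.nat_diff_reindex[of "\<lambda>k. r ^ k" M])
  also have "\<dots> \<le> K * (2 * (1 / (1 - r)))"
    using K geometric by (intro mult_left_mono) auto
  finally show ?thesis by (simp add: birkhoff_sum_def sum_subtractf r_def mult.commute)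
qed

context quasi_independent_shift
begin

text \<open>The function is the pointwise limit of functions of the coordinates in \<open>{-m..<m}\<close>.\<close>

lemma hoelder_measurable:
  assumes hoelder: "\<And>w v. w \<in> \<Omega> \<Longrightarrow> v \<in> \<Omega> \<Longrightarrow> \<bar>f w - f v\<bar> \<le> K * seq_dist w v powr \<alpha>"
    and K: "K \<ge> 0" and \<alpha>: "\<alpha> > 0"
  shows "f \<in> borel_measurable \<mu>"
proof (rule borel_measurable_LIMSEQ_real)
  define rep where "rep m w = (SOME v. v \<in> window_cylinder \<Omega> (- int m) (int m) w)" for m w
  show "(\<lambda>w. f (rep m w)) \<in> borel_measurable \<mu>" for m
    unfolding rep_def by (rule determined_on_measurable[OF determined_on_representative])
  show "(\<lambda>m. f (rep m w)) \<longlonglongrightarrow> f w" if "w \<in> space \<mu>" for w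
  proof -
    have w: "w \<in> \<Omega>" using that space_eq by simp
    have "\<bar>f (rep m w) - f w\<bar> \<le> K * exp (- \<alpha>) ^ m" for m
    proof -
      have "rep m w \<in> window_cylinder \<Omega> (- int m) (int m) w"
        unfolding rep_def by (rule representative_in_window_cylinder[OF w])
      then have rep: "rep m w \<in> \<Omega>" "\<forall>i\<in>{- int m..<int m}. rep m w i = w i"
        unfolding window_cylinder_def by blast+
      have "rep m w n = w n" if "\<bar>n\<bar> < int m" for n
        using that by (intro rep(2)[rule_format]) auto
      from hoelder_agree_bound[OF hoelder K \<alpha> rep(1) w this] show ?thesis .
    qed
    then have "\<forall>\<^sub>F m in sequentially. norm (f (rep m w) - f w) \<le> K * exp (- \<alpha>) ^ m"
      by (intro always_eventually allI) (simp only: real_norm_def)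
    moreover have "(\<lambda>m. K * exp (- \<alpha>) ^ m) \<longlonglongrightarrow> 0"
      by (rule tendsto_mult_right_zero[OF LIMSEQ_power_zero]) (use \<alpha> in simp)
    ultimately have "(\<lambda>m. f (rep m w) - f w) \<longlonglongrightarrow> 0"
      by (rule Lim_null_comparison)
    then show ?thesis by (rule LIM_zero_cancel)
  qed
qed

section \<open>Exponential moments and the Chernoff bound\<close>

lemma integrable_exp_birkhoff_sum:
  assumes "f \<in> borel_measurable \<mu>" "\<And>w. w \<in> \<Omega> \<Longrightarrow> f w \<le> B" "t \<ge> 0"
  shows "integrable \<mu> (\<lambda>w. exp (t * birkhoff_sum shift f n w))"
proof (rule integrable_const_bound)
  note [measurable] = measurable_birkhoff_sum[OF shift_measurable assms(1)]
  show "(\<lambda>w. exp (t * birkhoff_sum shift f n w)) \<in> borel_measurable \<mu>" by measurable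
  show "AE w in \<mu>. norm (exp (t * birkhoff_sum shift f n w)) \<le> exp (t * (real n * B))"
    using birkhoff_sum_le[OF shift_closed assms(2)] assms(3)
    by (auto simp: space_eq intro!: AE_I2 mult_left_mono)
qed

text \<open>Each block sum is replaced by a function of that block alone, namely the block sum of a
  representative plus \<open>D\<close>. It lies above the original block sum, and by at most \<open>2 * D\<close>: one
  \<open>D\<close> is the added constant, the other the possible gap between point and representative.\<close>

lemma exp_moment_blocks_le:
  assumes meas: "f \<in> borel_measurable \<mu>" and B: "\<And>w. w \<in> \<Omega> \<Longrightarrow> f w \<le> B"
    and var: "\<And>w v. w \<in> \<Omega> \<Longrightarrow> v \<in> \<Omega> \<Longrightarrow> \<forall>i\<in>{0..<int M}. w i = v i \<Longrightarrow>
      birkhoff_sum shift f M w \<le> birkhoff_sum shift f M v + D"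
    and M: "M \<ge> 1" and t: "t \<ge> 0"
  shows "(\<integral>w. exp (t * birkhoff_sum shift f (q * M) w) \<partial>\<mu>)
    \<le> (C * exp (2 * D * t) * (\<integral>w. exp (t * birkhoff_sum shift f M w) \<partial>\<mu>)) ^ q"
proof -
  define rep where "rep w = (SOME v. v \<in> window_cylinder \<Omega> 0 (int M) w)" for w
  define g where "g w = exp (t * (birkhoff_sum shift f M (rep w) + D))" for w
  have rep: "rep w \<in> \<Omega>" "\<forall>i\<in>{0..<int M}. rep w i = w i" if "w \<in> \<Omega>" for w
  proof -
    have "rep w \<in> window_cylinder \<Omega> 0 (int M) w"
      unfolding rep_def by (rule representative_in_window_cylinder[OF that])
    then show "rep w \<in> \<Omega>" "\<forall>i\<in>{0..<int M}. rep w i = w i"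
      unfolding window_cylinder_def by blast+
  qed
  have det: "determined_on \<Omega> 0 (int M) g"
    unfolding g_def rep_def by (rule determined_on_representative)
  have lower: "exp (t * birkhoff_sum shift f M w) \<le> g w" if "w \<in> \<Omega>" for w
    using var[of w "rep w"] rep[OF that] that t by (auto simp: g_def intro!: mult_left_mono)
  have upper: "g w \<le> exp (2 * D * t) * exp (t * birkhoff_sum shift f M w)" if "w \<in> \<Omega>" for w
  proof -
    have "t * (birkhoff_sum shift f M (rep w) + D) \<le> t * (birkhoff_sum shift f M w + 2 * D)"
      using var[of "rep w" w] rep[OF that] that t by (intro mult_left_mono) auto
    then show ?thesis by (simp add: g_def exp_add[symmetric] algebra_simps)
  qed
  have g_nonneg: "0 \<le> g w" for w by (simp add: g_def)
  have prod_det: "integrable \<mu> (\<lambda>w. \<Prod>j<q. g ((shift ^^ (j * M)) w))"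
  proof (rule integrable_const_bound)
    note [measurable] = determined_on_measurable[OF det]
    have [measurable]: "(shift ^^ k) \<in> measurable \<mu> \<mu>" for k by simp
    show "(\<lambda>w. \<Prod>j<q. g ((shift ^^ (j * M)) w)) \<in> borel_measurable \<mu>" by measurable
    have "g w \<le> exp (t * (real M * B + D))" if "w \<in> \<Omega>" for w
      using birkhoff_sum_le[OF shift_closed B rep(1)[OF that]] t
      by (auto simp: g_def intro!: mult_left_mono)
    then have "(\<Prod>j<q. g ((shift ^^ (j * M)) w)) \<le> (\<Prod>j<q. exp (t * (real M * B + D)))" if "w \<in> \<Omega>" for w
      using that by (intro prod_mono conjI) (auto simp: funpow_shift_closed g_nonneg)
    then show "AE w in \<mu>. norm (\<Prod>j<q. g ((shift ^^ (j * M)) w)) \<le> exp (t * (real M * B + D)) ^ q"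
      by (auto simp: space_eq g_nonneg prod_nonneg intro!: AE_I2)
  qed
  have "(\<integral>w. exp (t * birkhoff_sum shift f (q * M) w) \<partial>\<mu>)
      = (\<integral>w. (\<Prod>j<q. exp (t * birkhoff_sum shift f M ((shift ^^ (j * M)) w))) \<partial>\<mu>)"
    by (simp add: birkhoff_sum_mult sum_distrib_left exp_sum)
  also have "\<dots> \<le> (\<integral>w. (\<Prod>j<q. g ((shift ^^ (j * M)) w)) \<partial>\<mu>)"
  proof (rule integral_mono)
    show "integrable \<mu> (\<lambda>w. \<Prod>j<q. exp (t * birkhoff_sum shift f M ((shift ^^ (j * M)) w)))"
      using integrable_exp_birkhoff_sum[OF meas B t, of "q * M"]
      by (simp add: birkhoff_sum_mult sum_distrib_left exp_sum)
  qed (auto intro!: prod_det prod_mono lower funpow_shift_closed simp: space_eq)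
  also have "\<dots> \<le> (C * (\<integral>w. g w \<partial>\<mu>)) ^ q"
    by (rule integral_prod_blocks_le[OF det M]) (simp add: g_def)
  also have "\<dots> \<le> (C * exp (2 * D * t) * (\<integral>w. exp (t * birkhoff_sum shift f M w) \<partial>\<mu>)) ^ q"
  proof (rule power_mono)
    have "(\<integral>w. g w \<partial>\<mu>) \<le> (\<integral>w. exp (2 * D * t) * exp (t * birkhoff_sum shift f M w) \<partial>\<mu>)"
      using integrable_exp_birkhoff_sum[OF meas B t, of M]
      by (intro integral_mono determined_on_integrable[OF det] upper) (auto simp: space_eq)
    then show "C * (\<integral>w. g w \<partial>\<mu>) \<le> C * exp (2 * D * t) * (\<integral>w. exp (t * birkhoff_sum shift f M w) \<partial>\<mu>)"
      using C_ge_1 by (simp add: mult.assoc)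
    show "0 \<le> C * (\<integral>w. g w \<partial>\<mu>)"
      using C_ge_1 by (intro mult_nonneg_nonneg integral_nonneg_AE) (auto simp: g_def)
  qed
  finally show ?thesis .
qed

text \<open>The average over \<open>{0..<M}\<close> is at most \<open>a\<close> outside the event on the right, and at most \<open>B\<close> on
  it. By the weak law this event becomes negligible as \<open>M\<close> grows with \<open>s\<close> fixed.\<close>

lemma exp_moment_average_le:
  assumes meas: "f \<in> borel_measurable \<mu>" and B: "\<And>w. w \<in> \<Omega> \<Longrightarrow> f w \<le> B"
    and M: "M \<ge> 1" and s: "s \<ge> 0" 
  shows "(\<integral>w. exp (s / real M * birkhoff_sum shift f M w) \<partial>\<mu>)
    \<le> exp (s * a) + exp (s * B) * prob {w \<in> space \<mu>. birkhoff_sum shift f M w \<ge> a * real M}"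
proof -
  note [measurable] = measurable_birkhoff_sum[OF shift_measurable meas]
  define E where "E = {w \<in> space \<mu>. birkhoff_sum shift f M w \<ge> a * real M}"
  have [measurable]: "E \<in> sets \<mu>" unfolding E_def by measurable
  have "(\<integral>w. exp (s / real M * birkhoff_sum shift f M w) \<partial>\<mu>)
      \<le> (\<integral>w. exp (s * a) + exp (s * B) * indicat_real E w \<partial>\<mu>)"
  proof (rule integral_mono)
    show "integrable \<mu> (\<lambda>w. exp (s / real M * birkhoff_sum shift f M w))"
      using s by (intro integrable_exp_birkhoff_sum[where B = B] meas B) auto
    show "integrable \<mu> (\<lambda>w. exp (s * a) + exp (s * B) * indicat_real E w)"
      by (simp add: emeasure_eq_measure)
    fix w assume w: "w \<in> space \<mu>"
    have scale: "s / real M * birkhoff_sum shift f M w \<le> s * x" if "birkhoff_sum shift f M w \<le> x * real M" for x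
    proof -
      have "s / real M * birkhoff_sum shift f M w \<le> s / real M * (x * real M)"
        using that s by (intro mult_left_mono) auto
      then show ?thesis using M by simp
    qed
    show "exp (s / real M * birkhoff_sum shift f M w) \<le> exp (s * a) + exp (s * B) * indicat_real E w"
    proof (cases "w \<in> E")
      case True
      have "birkhoff_sum shift f M w \<le> B * real M"
        using birkhoff_sum_le[where f = f and B = B, OF shift_closed, of w M] B w
        by (simp add: space_eq mult.commute)
      from scale[OF this] True show ?thesis by (simp add: add_increasing)
    next
      case False
      then have "birkhoff_sum shift f M w \<le> a * real M" using w by (simp add: E_def)
      from scale[OF this] False show ?thesis by simp
    qed
  qed
  also have "\<dots> = exp (s * a) + exp (s * B) * prob E"
    by (simp add: emeasure_eq_measure prob_space)
  finally show ?thesis by (simp add: E_def)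
qed

text \<open>With \<open>exp (s * e / 2) = 8 * C\<close> and \<open>M\<close> large, the moment of one block is at most
  \<open>C * 2 * (8 * C + 1) \<le> 32 * C\<^sup>2 = exp (s * e) / 2\<close>, against the factor \<open>exp (s * e)\<close> per block
  from Markov's inequality.\<close>

lemma upper_large_deviation:
  assumes hoelder: "\<And>w v. w \<in> \<Omega> \<Longrightarrow> v \<in> \<Omega> \<Longrightarrow> \<bar>f w - f v\<bar> \<le> K * seq_dist w v powr \<alpha>"
    and K: "K \<ge> 0" and \<alpha>: "\<alpha> > 0" and B: "\<And>w. w \<in> \<Omega> \<Longrightarrow> \<bar>f w\<bar> \<le> B"
    and mean: "(\<integral>w. f w \<partial>\<mu>) = 0" and e: "e > 0"
  shows "\<exists>A>0. \<exists>c>0. \<forall>n. prob {w \<in> space \<mu>. birkhoff_sum shift f n w \<ge> e * real n} \<le> A * exp (- c * real n)"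
proof -
  have meas: "f \<in> borel_measurable \<mu>" by (rule hoelder_measurable[OF hoelder K \<alpha>])
  note [measurable] = measurable_birkhoff_sum[OF shift_measurable meas]
  have B1: "f w \<le> B" if "w \<in> \<Omega>" for w
    using B[OF that] by linarith
  have f_int: "integrable \<mu> f"
    using B by (intro integrable_const_bound[where B = B] AE_I2 meas) (auto simp: space_eq)
  have B0: "B \<ge> 0"
  proof -
    obtain w where "w \<in> \<Omega>" using not_empty space_eq by blast
    from B[OF this] show ?thesis by linarith
  qed
  define D where "D = 2 * K / (1 - exp (- \<alpha>))"
  define s where "s = 2 * ln (8 * C) / e"
  have s: "s \<ge> 0" using C_ge_1 e by (simp add: s_def)
  have exp_s: "exp (s * (e / 2)) = 8 * C" using C_ge_1 e by (simp add: s_def)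
  have "(\<lambda>M. exp (s * B) * prob {w \<in> space \<mu>. birkhoff_sum shift f M w \<ge> e / 2 * real M}) \<longlonglongrightarrow> 0"
    using prob_birkhoff_sum_tendsto_0[OF erg f_int mean, of "e / 2"] e
    by (intro tendsto_mult_right_zero) auto
  then have "eventually (\<lambda>M. exp (s * B) * prob {w \<in> space \<mu>. birkhoff_sum shift f M w \<ge> e / 2 * real M} < 1) sequentially"
    by (rule order_tendstoD) simp
  moreover have "(\<lambda>M. 2 * D * s / real M) \<longlonglongrightarrow> 0" by (rule lim_const_over_n)
  then have "eventually (\<lambda>M. 2 * D * s / real M < ln 2) sequentially"
    by (rule order_tendstoD) simp
  ultimately have "eventually (\<lambda>M. exp (s * B) * prob {w \<in> space \<mu>. birkhoff_sum shift f M w \<ge> e / 2 * real M} < 1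
      \<and> 2 * D * s / real M < ln 2 \<and> M \<ge> 1) sequentially"
    using eventually_ge_at_top[of 1] by eventually_elim simp
  then have "\<exists>M. exp (s * B) * prob {w \<in> space \<mu>. birkhoff_sum shift f M w \<ge> e / 2 * real M} < 1
      \<and> 2 * D * s / real M < ln 2 \<and> M \<ge> 1"
    by (rule eventually_happens'[OF sequentially_bot])
  then obtain M where
    M_prob: "exp (s * B) * prob {w \<in> space \<mu>. birkhoff_sum shift f M w \<ge> e / 2 * real M} < 1"
    and M_D: "2 * D * s / real M < ln 2" and M: "M \<ge> 1"
    by blast
  \<comment> \<open>With this scaling one block of length \<open>M\<close> has the exponent \<open>s\<close> times its average.\<close>
  define t where "t = s / real M"
  have t: "t \<ge> 0" using s by (simp add: t_def)
  define \<beta> where "\<beta> = C * exp (2 * D * t) * (\<integral>w. exp (t * birkhoff_sum shift f M w) \<partial>\<mu>)"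
  have \<beta>0: "0 \<le> \<beta>" using C_ge_1 by (simp add: \<beta>_def)
  have moment: "(\<integral>w. exp (t * birkhoff_sum shift f (q * M) w) \<partial>\<mu>) \<le> \<beta> ^ q" for q
    unfolding \<beta>_def D_def
    by (rule exp_moment_blocks_le[OF meas B1 birkhoff_sum_bounded_variation[OF hoelder K \<alpha> shift_closed] M t])
  have \<beta>_le: "\<beta> \<le> exp (s * e) / 2"
  proof -
    have "(\<integral>w. exp (t * birkhoff_sum shift f M w) \<partial>\<mu>) \<le> 16 * C"
      using exp_moment_average_le[OF meas B1 M s, of "e / 2"] M_prob exp_s C_ge_1
      by (simp add: t_def)
    moreover have "exp (2 * D * t) \<le> 2"
    proof -
      have "exp (2 * D * t) \<le> exp (ln 2)"
        using M_D unfolding exp_le_cancel_iff by (simp add: t_def)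
      then show ?thesis by simp
    qed
    ultimately have "\<beta> \<le> C * 2 * (16 * C)"
      unfolding \<beta>_def using C_ge_1 by (intro mult_mono) auto
    also have "\<dots> = exp (s * (e / 2)) * exp (s * (e / 2)) / 2"
      unfolding exp_s by simp
    also have "\<dots> = exp (s * e) / 2"
      by (simp add: exp_add[symmetric])
    finally show ?thesis .
  qed
  have bound: "prob {w \<in> space \<mu>. birkhoff_sum shift f n w \<ge> e * real n}
      \<le> 2 * exp (s * B) * exp (- (ln 2 / real M) * real n)" for n
  proof -
    define q where "q = n div M"
    define E where "E = {w \<in> space \<mu>. birkhoff_sum shift f n w \<ge> e * real n}"
    have [measurable]: "E \<in> sets \<mu>" unfolding E_def by measurable
    have n_split: "n = q * M + n mod M" and qM: "real q * real M \<le> real n"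
      and n_less: "real n \<le> (real q + 1) * real M"
    proof -
      show n: "n = q * M + n mod M" by (simp add: q_def)
      have "n mod M < M" using M by (intro mod_less_divisor) auto
      with n have "q * M \<le> n" "n \<le> (q + 1) * M" by (linarith, simp)
      then have "real (q * M) \<le> real n" "real n \<le> real ((q + 1) * M)"
        by (simp_all only: of_nat_le_iff)
      then show "real q * real M \<le> real n" "real n \<le> (real q + 1) * real M"
        by (simp_all add: algebra_simps)
    qed
    \<comment> \<open>The incomplete last block adds at most \<open>M * B\<close>, hence at most \<open>s * B\<close> to the exponent.\<close>
    have key: "exp (s * e * real q - s * B) * indicat_real E w \<le> exp (t * birkhoff_sum shift f (q * M) w)"
      if w: "w \<in> space \<mu>" for w
    proof (cases "w \<in> E")
      case True
      have "birkhoff_sum shift f (n mod M) ((shift ^^ (q * M)) w) \<le> real (n mod M) * B"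
        using w by (intro birkhoff_sum_le[OF shift_closed B1] funpow_shift_closed) (auto simp: space_eq)
      also have "\<dots> \<le> real M * B" using B0 M by (intro mult_right_mono) auto
      finally have "birkhoff_sum shift f n w \<le> birkhoff_sum shift f (q * M) w + real M * B"
        using birkhoff_sum_add[of shift f "q * M" "n mod M" w] n_split by simp
      moreover have "e * (real q * real M) \<le> e * real n" using qM e by simp
      ultimately have "e * (real q * real M) - real M * B \<le> birkhoff_sum shift f (q * M) w"
        using True by (simp add: E_def)
      then have "t * (e * (real q * real M) - real M * B) \<le> t * birkhoff_sum shift f (q * M) w"
        using t by (rule mult_left_mono)
      moreover have "t * (e * (real q * real M) - real M * B) = s * e * real q - s * B"
        using M by (simp add: t_def right_diff_distrib)
      ultimately show ?thesis using True by simp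
    qed simp
    have "exp (s * e * real q - s * B) * prob E = (\<integral>w. exp (s * e * real q - s * B) * indicat_real E w \<partial>\<mu>)"
      by (simp add: emeasure_eq_measure)
    also have "\<dots> \<le> (\<integral>w. exp (t * birkhoff_sum shift f (q * M) w) \<partial>\<mu>)"
      by (intro integral_mono key integrable_exp_birkhoff_sum[where B = B] meas B1 t)
        (auto simp: emeasure_eq_measure)
    also have "\<dots> \<le> (exp (s * e) / 2) ^ q"
      using moment[of q] power_mono[OF \<beta>_le \<beta>0, of q] by simp
    also have "\<dots> = exp (s * e * real q) * (1 / 2) ^ q"
      using exp_of_nat_mult[of q "s * e"] by (simp add: power_divide mult.commute)
    finally have "exp (s * B) * (exp (s * e * real q - s * B) * prob E)
        \<le> exp (s * B) * (exp (s * e * real q) * (1 / 2) ^ q)"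
      by (rule mult_left_mono) simp
    also have "exp (s * B) * (exp (s * e * real q - s * B) * prob E) = exp (s * e * real q) * prob E"
      unfolding mult.assoc[symmetric] exp_add[symmetric] by simp
    also have "exp (s * B) * (exp (s * e * real q) * (1 / 2) ^ q) = exp (s * e * real q) * (exp (s * B) * (1 / 2) ^ q)"
      by (rule mult.left_commute)
    finally have "prob E \<le> exp (s * B) * (1 / 2) ^ q"
      by (rule mult_left_le_imp_le) simp
    \<comment> \<open>Since \<open>n\<close> is at most \<open>(q + 1) * M\<close>, rounding down to whole blocks costs a factor of two.\<close>
    also have "\<dots> \<le> exp (s * B) * (2 * exp (- (ln 2 / real M) * real n))"
    proof (intro mult_left_mono)
      have "exp (- ln 2 * (real q + 1)) = exp (real (Suc q) * - ln 2)" by (simp add: algebra_simps)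
      also have "\<dots> = exp (- ln 2) ^ Suc q" by (rule exp_of_nat_mult)
      also have "exp (- ln 2) = (1 / 2 :: real)" by (simp add: exp_minus)
      finally have "(1 / 2 :: real) ^ q = 2 * exp (- ln 2 * (real q + 1))" by simp
      moreover have "ln 2 * (real n / real M) \<le> ln 2 * (real q + 1)"
        using n_less M by (intro mult_left_mono) (simp_all add: pos_divide_le_eq)
      then have "exp (- ln 2 * (real q + 1)) \<le> exp (- (ln 2 / real M) * real n)" by simp
      ultimately show "(1 / 2 :: real) ^ q \<le> 2 * exp (- (ln 2 / real M) * real n)" by linarith
    qed simp
    finally show ?thesis by (simp add: E_def)
  qed
  show ?thesis
  proof (rule exI[of _ "2 * exp (s * B)"], intro conjI, simp, rule exI[of _ "ln 2 / real M"], intro conjI allI)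
    show "ln 2 / real M > 0" using M by simp
  qed (rule bound)
qed

end

section \<open>Exponential large deviations\<close>

text \<open>The upper half of bounded distortion bounds a quotient, which says nothing about the numerator
  when the denominator vanishes. In that case the intersection is a null set as well.\<close>

lemma bounded_distortion_upper:
  assumes "prob_space \<mu>" "space \<mu> = \<Omega>" and dist: "bounded_distortion \<Omega> \<mu>"
    and meas: "\<And>a b w. window_cylinder \<Omega> a b w \<in> sets \<mu>"
  obtains C where "C \<ge> 1" "\<And>a b c w v. a \<le> b \<Longrightarrow> b < c \<Longrightarrow>
      measure \<mu> (window_cylinder \<Omega> a b w \<inter> window_cylinder \<Omega> b c v)
        \<le> C * (measure \<mu> (window_cylinder \<Omega> a b w) * measure \<mu> (window_cylinder \<Omega> b c v))"
proof -
  interpret prob_space \<mu> by fact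
  obtain C where C: "C \<ge> 1" and upper: "\<And>n k j l m i. l > n + int k \<Longrightarrow>
      cylinder \<Omega> n k j \<inter> cylinder \<Omega> l m i \<noteq> {} \<Longrightarrow>
      prob (cylinder \<Omega> n k j \<inter> cylinder \<Omega> l m i) / (prob (cylinder \<Omega> n k j) * prob (cylinder \<Omega> l m i)) \<le> C"
    using dist unfolding bounded_distortion_def by blast
  show thesis
  proof (rule that[OF C])
    fix a b c :: int and w v assume le: "a \<le> b" "b < c"
    let ?Z = "window_cylinder \<Omega> a b w" and ?Y = "window_cylinder \<Omega> b c v"
    consider "a = b" | "?Z \<inter> ?Y = {}" | "prob ?Z * prob ?Y = 0"
      | "a < b" "?Z \<inter> ?Y \<noteq> {}" "prob ?Z * prob ?Y \<noteq> 0"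
      using le by linarith
    then show "prob (?Z \<inter> ?Y) \<le> C * (prob ?Z * prob ?Y)"
    proof cases
      case 1
      then have Z: "?Z = \<Omega>" by (auto simp: window_cylinder_def)
      have "prob ?Z = 1" unfolding Z using assms(2) prob_space by simp
      moreover have "prob (?Z \<inter> ?Y) \<le> prob ?Y" using meas by (intro finite_measure_mono) auto
      moreover have "1 * prob ?Y \<le> C * prob ?Y" using C by (intro mult_right_mono) auto
      ultimately show ?thesis by simp
    next
      case 3
      have "prob (?Z \<inter> ?Y) \<le> prob ?Z" "prob (?Z \<inter> ?Y) \<le> prob ?Y"
        using meas by (auto intro!: finite_measure_mono)
      with 3 show ?thesis by auto
    next
      case 4
      have "prob (?Z \<inter> ?Y) / (prob ?Z * prob ?Y) \<le> C"
        using 4(2) unfolding window_cylinder_eq_cylinder[OF 4(1)] window_cylinder_eq_cylinder[OF le(2)]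
        by (rule upper[rotated]) (use 4(1) in auto)
      moreover have "0 < prob ?Z * prob ?Y" using 4(3) by (simp add: less_le)
      ultimately show ?thesis by (simp add: pos_divide_le_eq)
    qed (use C in auto)
  qed
qed

theorem theorem3p1:
  fixes l :: nat and \<Omega> :: "(int \<Rightarrow> nat) set" and \<mu> :: "(int \<Rightarrow> nat) measure"
    and f :: "(int \<Rightarrow> nat) \<Rightarrow> real" and \<alpha> :: real
  assumes "l \<ge> 2"
    and "subshift_of_finite_type l \<Omega>"
    and "topologically_mixing \<Omega>"
    and "prob_space \<mu>" and "sets \<mu> = sets (seq_borel \<Omega>)"
    and "ergodic \<mu> shift"
    and "full_support \<Omega> \<mu>"
    and "bounded_distortion \<Omega> \<mu>"
    and "0 < \<alpha>" and "\<alpha> \<le> 1" and "hoelder_on \<alpha> \<Omega> f"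
  shows "\<forall>\<epsilon>>0. \<exists>C>0. \<exists>c>0. \<forall>n::nat. n \<ge> 1 \<longrightarrow>
    measure \<mu> {w \<in> \<Omega>. \<bar>(1 / real n) * (\<Sum>k = 0..<n. f ((shift ^^ k) w)) - (\<integral>w. f w \<partial>\<mu>)\<bar> \<ge> \<epsilon>}
      < C * exp (- c * real n)"
proof (intro allI impI)
  fix \<epsilon> :: real assume \<epsilon>: "\<epsilon> > 0"
  have space: "space \<mu> = \<Omega>"
    using sets_eq_imp_space_eq[OF assms(5)] by (simp add: space_seq_borel)
  have "window_cylinder \<Omega> a b w \<in> sets \<mu>" for a b w
    unfolding assms(5) by (rule sets_seq_borel_openin) (rule openin_window_cylinder)
  from bounded_distortion_upper[OF assms(4) space assms(8) this]
  obtain C where C: "C \<ge> 1" "\<And>a b c w v. a \<le> b \<Longrightarrow> b < c \<Longrightarrow>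
      measure \<mu> (window_cylinder \<Omega> a b w \<inter> window_cylinder \<Omega> b c v)
        \<le> C * (measure \<mu> (window_cylinder \<Omega> a b w) * measure \<mu> (window_cylinder \<Omega> b c v))"
    by metis
  interpret prob_space \<mu> by fact
  interpret quasi_independent_shift \<mu> \<Omega> l C
  proof
    show "\<Omega> \<subseteq> full_shift l" using assms(2) by (auto simp: subshift_of_finite_type_def)
  qed (fact assms C)+
  obtain K0 where K0: "\<And>w v. w \<in> \<Omega> \<Longrightarrow> v \<in> \<Omega> \<Longrightarrow> \<bar>f w - f v\<bar> \<le> K0 * seq_dist w v powr \<alpha>"
    using assms(11) unfolding hoelder_on_def by blast
  define K where "K = \<bar>K0\<bar>"
  have K: "K \<ge> 0" by (simp add: K_def)
  have hoelder: "\<bar>f w - f v\<bar> \<le> K * seq_dist w v powr \<alpha>" if "w \<in> \<Omega>" "v \<in> \<Omega>" for w v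
  proof -
    have "K0 * seq_dist w v powr \<alpha> \<le> K * seq_dist w v powr \<alpha>"
      by (rule mult_right_mono) (simp_all add: K_def)
    with K0[OF that] show ?thesis by linarith
  qed
  define m where "m = (\<integral>w. f w \<partial>\<mu>)"
  obtain v where v: "v \<in> \<Omega>" using not_empty space by blast
  define B where "B = K + \<bar>f v\<bar> + \<bar>m\<bar>"
  have f_le: "\<bar>f w\<bar> \<le> K + \<bar>f v\<bar>" if "w \<in> \<Omega>" for w
    using hoelder_agree_bound[OF hoelder K assms(9) that v, of 0] by simp
  have f_int: "integrable \<mu> f"
    by (rule integrable_const_bound[where B = "K + \<bar>f v\<bar>"])
      (use f_le in \<open>auto simp: space intro!: AE_I2 hoelder_measurable[OF hoelder K assms(9)]\<close>)
  have mean: "(\<integral>w. f w - m \<partial>\<mu>) = 0"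
    using f_int by (simp add: m_def prob_space)
  \<comment> \<open>The same one-sided bound for \<open>f - m\<close> and for its negative gives both tails.\<close>
  have pos: "\<exists>A>0. \<exists>c>0. \<forall>n. prob {w \<in> space \<mu>. birkhoff_sum shift (\<lambda>w. f w - m) n w \<ge> \<epsilon> * real n}
      \<le> A * exp (- c * real n)"
  proof (rule upper_large_deviation[OF _ K assms(9) _ _ \<epsilon>])
    show "\<bar>f w - m\<bar> \<le> B" if "w \<in> \<Omega>" for w using f_le[OF that] by (simp add: B_def)
    show "\<bar>f w - m - (f v - m)\<bar> \<le> K * seq_dist w v powr \<alpha>" if "w \<in> \<Omega>" "v \<in> \<Omega>" for w v
      using hoelder[OF that] by simp
  qed (rule mean)
  have neg: "\<exists>A>0. \<exists>c>0. \<forall>n. prob {w \<in> space \<mu>. birkhoff_sum shift (\<lambda>w. - (f w - m)) n w \<ge> \<epsilon> * real n}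
      \<le> A * exp (- c * real n)"
  proof (rule upper_large_deviation[OF _ K assms(9) _ _ \<epsilon>])
    show "\<bar>- (f w - m)\<bar> \<le> B" if "w \<in> \<Omega>" for w using f_le[OF that] by (simp add: B_def)
    show "\<bar>- (f w - m) - - (f v - m)\<bar> \<le> K * seq_dist w v powr \<alpha>" if "w \<in> \<Omega>" "v \<in> \<Omega>" for w v
      using hoelder[OF that] by simp
    show "(\<integral>w. - (f w - m) \<partial>\<mu>) = 0"
      unfolding Bochner_Integration.integral_minus mean by simp
  qed
  obtain A1 c1 A2 c2 where A: "A1 > 0" "c1 > 0" "A2 > 0" "c2 > 0"
    and upper: "\<And>n. prob {w \<in> space \<mu>. birkhoff_sum shift (\<lambda>w. f w - m) n w \<ge> \<epsilon> * real n} \<le> A1 * exp (- c1 * real n)"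
    and lower: "\<And>n. prob {w \<in> space \<mu>. birkhoff_sum shift (\<lambda>w. - (f w - m)) n w \<ge> \<epsilon> * real n} \<le> A2 * exp (- c2 * real n)"
    using pos neg by blast
  define c where "c = min c1 c2"
  have meas: "birkhoff_sum shift (\<lambda>w. f w - m) n \<in> borel_measurable \<mu>"
    "birkhoff_sum shift (\<lambda>w. - (f w - m)) n \<in> borel_measurable \<mu>" for n
    using f_int by (auto intro!: measurable_birkhoff_sum shift_measurable)
  note [measurable] = meas
  have "prob {w \<in> \<Omega>. \<bar>(1 / real n) * (\<Sum>k = 0..<n. f ((shift ^^ k) w)) - m\<bar> \<ge> \<epsilon>}
      < (A1 + A2 + 1) * exp (- c * real n)" if n: "n \<ge> 1" for n
  proof -
    define U where "U = {w \<in> space \<mu>. birkhoff_sum shift (\<lambda>w. f w - m) n w \<ge> \<epsilon> * real n}"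
    define L where "L = {w \<in> space \<mu>. birkhoff_sum shift (\<lambda>w. - (f w - m)) n w \<ge> \<epsilon> * real n}"
    have U: "U \<in> sets \<mu>" unfolding U_def by measurable
    have L: "L \<in> sets \<mu>" unfolding L_def by measurable
    have sub: "{w \<in> \<Omega>. \<bar>(1 / real n) * (\<Sum>k = 0..<n. f ((shift ^^ k) w)) - m\<bar> \<ge> \<epsilon>} \<subseteq> U \<union> L"
    proof
      fix w assume w: "w \<in> {w \<in> \<Omega>. \<bar>(1 / real n) * (\<Sum>k = 0..<n. f ((shift ^^ k) w)) - m\<bar> \<ge> \<epsilon>}"
      have "(1 / real n) * (\<Sum>k = 0..<n. f ((shift ^^ k) w)) - m = birkhoff_sum shift (\<lambda>w. f w - m) n w / real n"
        using n unfolding birkhoff_sum_diff_const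
        by (simp add: birkhoff_sum_def atLeast0LessThan diff_divide_distrib)
      with w n have "\<epsilon> * real n \<le> \<bar>birkhoff_sum shift (\<lambda>w. f w - m) n w\<bar>"
        by (simp add: pos_le_divide_eq)
      then show "w \<in> U \<union> L"
        using w unfolding U_def L_def birkhoff_sum_uminus mem_Collect_eq Un_iff space by argo
    qed
    have "prob {w \<in> \<Omega>. \<bar>(1 / real n) * (\<Sum>k = 0..<n. f ((shift ^^ k) w)) - m\<bar> \<ge> \<epsilon>} \<le> prob (U \<union> L)"
      by (rule finite_measure_mono[OF sub]) (rule sets.Un[OF U L])
    also have "\<dots> \<le> prob U + prob L" by (rule measure_Un_le[OF U L])
    also have "\<dots> \<le> A1 * exp (- c1 * real n) + A2 * exp (- c2 * real n)"
      unfolding U_def L_def using upper[of n] lower[of n] by (rule add_mono)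
    also have "\<dots> \<le> A1 * exp (- c * real n) + A2 * exp (- c * real n)"
    proof (rule add_mono)
      have "c * real n \<le> c1 * real n" "c * real n \<le> c2 * real n"
        by (rule mult_right_mono; simp add: c_def)+
      then show "A1 * exp (- c1 * real n) \<le> A1 * exp (- c * real n)"
        "A2 * exp (- c2 * real n) \<le> A2 * exp (- c * real n)"
        using A by simp_all
    qed
    \<comment> \<open>The additional one makes the inequality strict.\<close>
    also have "\<dots> < (A1 + A2 + 1) * exp (- c * real n)" by (simp add: ring_distribs)
    finally show ?thesis .
  qed
  then have tail: "\<forall>n::nat. n \<ge> 1 \<longrightarrow>
      prob {w \<in> \<Omega>. \<bar>(1 / real n) * (\<Sum>k = 0..<n. f ((shift ^^ k) w)) - (\<integral>w. f w \<partial>\<mu>)\<bar> \<ge> \<epsilon>}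
        < (A1 + A2 + 1) * exp (- c * real n)"
    unfolding m_def by simp
  have positive: "A1 + A2 + 1 > 0" "c > 0" using A by (auto simp: c_def)
  show "\<exists>C>0. \<exists>c>0. \<forall>n::nat. n \<ge> 1 \<longrightarrow>
      prob {w \<in> \<Omega>. \<bar>(1 / real n) * (\<Sum>k = 0..<n. f ((shift ^^ k) w)) - (\<integral>w. f w \<partial>\<mu>)\<bar> \<ge> \<epsilon>}
        < C * exp (- c * real n)"
    by (rule exI[of _ "A1 + A2 + 1"], rule conjI, rule positive(1), rule exI[of _ c], rule conjI,
        rule positive(2), rule tail)
qed

end
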